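(* Let $A$ be a set with $\operatorname{card} A \leq 2^{2^{\omega}}$. Then there exists a relation $R \subseteq A \times A$ such that for all $x, y \in A$ with $x \neq y$ there exists a set $A(x,y)$ with $\{x\} \subseteq A(x,y) \subseteq A$ and $\operatorname{card} A(x,y) \leq \omega$ such that no map $f : A(x,y) \to A$ with $f(x) = y$ is a homomorphism of $R$.
   Context: For a relation $R \subseteq A \times A$ and a subset $X \subseteq A$, a map $f : X \to A$ is called a homomorphism of $R$ if for all $u, v \in X$, $(u,v) \in R$ implies $(f(u), f(v)) \in R$. Here $\omega$ denotes the cardinal $\aleph_0$, and $2^{2^{\omega}}$ is cardinal exponentiation. The axiom of choice is assumed. *)

theory Defs
  imports "HOL-Library.FuncSet"
begin

unbundle cardinal_syntax

(* Only the values of f on X matter; f is a total function because HOL functions are. *)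
definition rel_hom_on :: "'a set \<Rightarrow> ('a \<times> 'a) set \<Rightarrow> 'a set \<Rightarrow> ('a \<Rightarrow> 'a) \<Rightarrow> bool" where
  "rel_hom_on A R X f \<longleftrightarrow>
     f \<in> X \<rightarrow> A \<and> (\<forall>u\<in>X. \<forall>v\<in>X. (u, v) \<in> R \<longrightarrow> (f u, f v) \<in> R)"

end

theory Submission
  imports Defs "HOL-Library.Countable_Set_Type"
begin

text \<open>
  For finite \<open>A\<close> a strict linear order works with \<open>X = A\<close>: a strictly monotone
  self-map of a finite chain is the identity. For infinite \<open>A\<close>, the exponent tower
  \<open>2 ^ (2 ^ \<omega>)\<close> is mirrored by splitting \<open>A\<close> into three levels: a countable core, a set \<open>P\<close> of
  at most \<open>2 ^ \<omega>\<close> points named by sets of core points, and a set \<open>Q\<close> of points named by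
  subsets of \<open>P\<close>. Membership of a point in a name is recorded by the direction of the edge
  between the two points. Directions, unlike mere adjacency, make homomorphisms preserve
  non-membership as well, so that different names are never compatible.

  Pairs joined in both directions occur only in the core, where they form a ray. Additional
  one-way edges inside the core force every homomorphism defined on the core to be the identity
  there (\<open>ray_edge_hom_id\<close>). Hence a homomorphism defined on the core and one further point
  keeps the core part of the name of this point (\<open>hom_nat_code\<close>), which determines the points
  of \<open>P\<close> and tells them apart from those of \<open>Q\<close>. Two different points of \<open>Q\<close> have names
  that differ at some \<open>s \<in> P\<close>; adding only this \<open>s\<close> to the domain separates them. So
  the core with at most two further points always suffices as \<open>X\<close>.
\<close>

section \<open>Rigidity of the core\<close>

text \<open>
  The symmetric part of this relation is the one-way infinite path on the natural numbers. The
  edges between numbers at distance two forbid homomorphisms to fold the path. They all point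
  downwards except the one between 0 and 2, so that the path cannot be shifted either.
\<close>
definition ray_edge :: "nat \<Rightarrow> nat \<Rightarrow> bool" where
  "ray_edge i j \<longleftrightarrow> j = Suc i \<or> i = Suc j \<or> (i = 0 \<and> j = 2) \<or> (0 < j \<and> i = j + 2)"

lemma ray_edge_sym_iff: "ray_edge i j \<and> ray_edge j i \<longleftrightarrow> j = Suc i \<or> i = Suc j"
  by (auto simp: ray_edge_def)

text \<open>
  A walk along the path that never turns back runs upwards for ever, since a descending one
  would have to stop at 0.
\<close>
lemma ray_edge_hom_id:
  assumes hom: "\<And>i j. ray_edge i j \<Longrightarrow> ray_edge (g i) (g j)"
  shows "g n = n"
proof -
  have step: "g (Suc n) = Suc (g n) \<or> g n = Suc (g (Suc n))" for n
  proof -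
    have "ray_edge n (Suc n)" "ray_edge (Suc n) n"
      by (simp_all add: ray_edge_def)
    then show ?thesis
      using hom ray_edge_sym_iff by blast
  qed
  have no_turn: "g (Suc (Suc n)) \<noteq> g n" for n
  proof -
    have "ray_edge n (Suc (Suc n)) \<or> ray_edge (Suc (Suc n)) n"
      by (auto simp: ray_edge_def)
    then have "ray_edge (g n) (g (Suc (Suc n))) \<or> ray_edge (g (Suc (Suc n))) (g n)"
      using hom by blast
    then show ?thesis by (auto simp: ray_edge_def)
  qed
  have start: "g (Suc 0) = Suc (g 0)"
  proof (rule ccontr)
    assume "g (Suc 0) \<noteq> Suc (g 0)"
    then have down0: "g 0 = Suc (g (Suc 0))" using step by blast
    have down: "g n = Suc (g (Suc n))" for n
    proof (induction n)
      case 0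
      show ?case by (rule down0)
    next
      case (Suc n)
      then show ?case using step[of "Suc n"] no_turn[of n] by auto
    qed
    have "g 0 = g n + n" for n
    proof (induction n)
      case (Suc n)
      then show ?case using down[of n] by simp
    qed simp
    from this[of "Suc (g 0)"] show False by simp
  qed
  have up: "g (Suc n) = Suc (g n)" for n
  proof (induction n)
    case 0
    show ?case by (rule start)
  next
    case (Suc n)
    then show ?case using step[of "Suc n"] no_turn[of n] by auto
  qed
  have shift: "g n = g 0 + n" for n
    by (induction n) (use up in auto)
  have "ray_edge (g 0) (g 2)"
    by (rule hom) (simp add: ray_edge_def)
  then have "g 0 = 0"
    using shift[of 2] by (auto simp: ray_edge_def)
  then show ?thesis using shift[of n] by simp
qed

section \<open>Points named by sets\<close>

lemma rel_hom_onD: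
  assumes "rel_hom_on A R X f" "u \<in> X" "v \<in> X" "(u, v) \<in> R"
  shows "(f u, f v) \<in> R"
  using assms by (auto simp: rel_hom_on_def)

lemma insert_0_Suc_image_inj:
  assumes "insert 0 (Suc ` M) = insert 0 (Suc ` N)"
  shows "M = N"
proof (rule set_eqI)
  fix n
  show "n \<in> M \<longleftrightarrow> n \<in> N"
    using assms[THEN eqset_imp_iff, of "Suc n"] by (simp add: image_iff)
qed

locale named_levels =
  fixes c :: "nat \<Rightarrow> 'a" and P Q :: "'a set"
    and S :: "'a \<Rightarrow> nat set" and F :: "'a \<Rightarrow> 'a set"
  assumes inj_c: "inj c"
    and core_disj: "range c \<inter> (P \<union> Q) = {}"
    and P_Q_disj: "P \<inter> Q = {}"
    and inj_S: "inj_on S P"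
    and inj_F: "inj_on F Q"
    and F_sub: "\<And>z. z \<in> Q \<Longrightarrow> F z \<subseteq> P"
begin

definition carrier :: "'a set" where
  "carrier = range c \<union> P \<union> Q"

text \<open>
  The element 0 marks the points of \<open>P\<close>, so that the code also tells \<open>P\<close> and \<open>Q\<close> apart.
\<close>
definition nat_code :: "'a \<Rightarrow> nat set" where
  "nat_code u = (if u \<in> P then insert 0 (Suc ` S u) else {})"

definition edges :: "('a \<times> 'a) set" where
  "edges =
     {(c i, c j) | i j. ray_edge i j}
     \<union> {(c n, u) | n u. u \<in> P \<union> Q \<and> n \<in> nat_code u}
     \<union> {(u, c n) | n u. u \<in> P \<union> Q \<and> n \<notin> nat_code u}
     \<union> {(s, z) | s z. s \<in> P \<and> z \<in> Q \<and> s \<in> F z}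
     \<union> {(z, s) | s z. s \<in> P \<and> z \<in> Q \<and> s \<notin> F z}"

lemma edges_sub: "edges \<subseteq> carrier \<times> carrier"
  by (auto simp: edges_def carrier_def)

lemma c_notin [simp]: "c n \<notin> P" "c n \<notin> Q"
  using core_disj by auto

lemma c_eq_iff [simp]: "c i = c j \<longleftrightarrow> i = j"
  using inj_c by (auto dest: injD)

lemma edges_core_core: "(c i, c j) \<in> edges \<longleftrightarrow> ray_edge i j"
  by (auto simp: edges_def)

lemma edges_core_out:
  assumes "u \<in> P \<union> Q"
  shows "(c n, u) \<in> edges \<longleftrightarrow> n \<in> nat_code u"
    and "(u, c n) \<in> edges \<longleftrightarrow> n \<notin> nat_code u"
  using assms by (auto simp: edges_def)

lemma edges_P_Q:
  assumes "s \<in> P" "z \<in> Q"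
  shows "(s, z) \<in> edges \<longleftrightarrow> s \<in> F z"
    and "(z, s) \<in> edges \<longleftrightarrow> s \<notin> F z"
  using assms P_Q_disj by (auto simp: edges_def)

lemma edges_irrefl: "(u, u) \<notin> edges"
  using P_Q_disj by (auto simp: edges_def ray_edge_def)

lemma edges_sym_core:
  assumes "(u, v) \<in> edges" "(v, u) \<in> edges"
  shows "u \<in> range c"
  using assms P_Q_disj by (auto simp: edges_def)

lemma hom_core_id:
  assumes hom: "rel_hom_on carrier edges X f" and X: "range c \<subseteq> X"
  shows "f (c n) = c n"
proof -
  have pres: "(f (c i), f (c j)) \<in> edges" if "ray_edge i j" for i j
    using X that by (intro rel_hom_onD[OF hom]) (auto simp: edges_core_core)
  have "f (c i) \<in> range c" for i
    by (rule edges_sym_core[of _ "f (c (Suc i))"]; rule pres) (simp_all add: ray_edge_def)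
  then have "\<forall>i. \<exists>j. f (c i) = c j" by blast
  then obtain g where g: "\<And>i. f (c i) = c (g i)" by metis
  have "ray_edge (g i) (g j)" if "ray_edge i j" for i j
    using pres[OF that] by (simp add: g edges_core_core)
  then have "g n = n" by (rule ray_edge_hom_id)
  then show ?thesis by (simp add: g)
qed

text \<open>
  Every point outside the core is adjacent to every core point, and there are no loops; so a
  homomorphism that fixes the core cannot move an outer point into it.
\<close>
lemma hom_nat_code:
  assumes hom: "rel_hom_on carrier edges X f" and X: "range c \<subseteq> X"
    and u: "u \<in> X" "u \<in> P \<union> Q"
  shows "f u \<in> P \<union> Q" and "nat_code (f u) = nat_code u"
proof -
  have core: "f (c n) = c n" for n
    by (rule hom_core_id[OF hom X])
  have into: "n \<in> nat_code u \<Longrightarrow> (c n, f u) \<in> edges"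
    and from_u: "n \<notin> nat_code u \<Longrightarrow> (f u, c n) \<in> edges" for n
    using rel_hom_onD[OF hom, of "c n" u] rel_hom_onD[OF hom, of u "c n"]
      X u core[of n] edges_core_out[OF u(2), of n] by auto
  have "f u \<noteq> c n" for n
    using into[of n] from_u[of n] edges_irrefl by metis
  moreover have "f u \<in> carrier"
    using hom u(1) by (auto simp: rel_hom_on_def)
  ultimately show out: "f u \<in> P \<union> Q"
    by (auto simp: carrier_def)
  show "nat_code (f u) = nat_code u"
    using into from_u edges_core_out[OF out] by blast
qed

lemma nat_code_P_iff: "0 \<in> nat_code u \<longleftrightarrow> u \<in> P"
  by (simp add: nat_code_def)

lemma nat_code_inj:
  assumes "nat_code u = nat_code v" "u \<in> P"
  shows "u = v"
proof -
  have v: "v \<in> P"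
    using assms nat_code_P_iff by metis
  have "insert 0 (Suc ` S u) = insert 0 (Suc ` S v)"
    using assms v by (simp add: nat_code_def)
  then have "S u = S v"
    by (rule insert_0_Suc_image_inj)
  then show ?thesis
    using inj_S assms(2) v by (auto dest: inj_onD)
qed

lemma hom_P_fixed:
  assumes "rel_hom_on carrier edges X f" "range c \<subseteq> X" "u \<in> X" "u \<in> P"
  shows "f u = u"
  using hom_nat_code(2)[OF assms(1-3)] assms(4) nat_code_inj[of u "f u"] by simp

text \<open>
  The domain has to grow with the pair of points only when both lie in \<open>Q\<close>: their codes in the
  core agree, and a point of \<open>P\<close> at which their names differ must be added.
\<close>
lemma countably_rigid:
  assumes x: "x \<in> carrier" and "x \<noteq> y"
  shows "\<exists>X. {x} \<subseteq> X \<and> X \<subseteq> carrier \<and> |X| \<le>o natLeq \<and>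
           \<not> (\<exists>f. f x = y \<and> rel_hom_on carrier edges X f)"
proof -
  have countable_bound: "|X| \<le>o natLeq" if "countable X" for X :: "'a set"
    using that countable_card_of_nat card_of_nat ordLeq_ordIso_trans by blast
  show ?thesis
  proof (cases "x \<in> Q \<and> y \<in> Q")
    case False
    let ?X = "insert x (range c)"
    have X: "range c \<subseteq> ?X" "x \<in> ?X" by blast+
    have "f x \<noteq> y" if hom: "rel_hom_on carrier edges ?X f" for f
    proof
      assume fx: "f x = y"
      have notcore: "x \<notin> range c"
        using hom_core_id[OF hom X(1)] fx \<open>x \<noteq> y\<close> by (metis imageE)
      then have out: "x \<in> P \<union> Q"
        using x by (auto simp: carrier_def)
      have "x \<notin> P"
        using hom_P_fixed[OF hom X] fx \<open>x \<noteq> y\<close> by auto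
      moreover have "y \<in> P \<union> Q" "nat_code y = nat_code x"
        using hom_nat_code[OF hom X out] fx by simp_all
      ultimately have "x \<in> Q \<and> y \<in> Q"
        using nat_code_P_iff[of x] nat_code_P_iff[of y] out by auto
      with False show False by simp
    qed
    moreover have "?X \<subseteq> carrier" "countable ?X"
      using x by (auto simp: carrier_def)
    ultimately show ?thesis
      using countable_bound[of ?X] by (intro exI[of _ ?X] conjI) blast+
  next
    case True
    then have "F x \<noteq> F y"
      using inj_F \<open>x \<noteq> y\<close> by (auto dest: inj_onD)
    then obtain s where s: "s \<in> P" "s \<in> F x \<longleftrightarrow> s \<notin> F y"
      using F_sub True by blast
    let ?X = "insert s (insert x (range c))"
    have "f x \<noteq> y" if hom: "rel_hom_on carrier edges ?X f" for f
    proof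
      assume fx: "f x = y"
      have fs: "f s = s"
        by (rule hom_P_fixed[OF hom _ _ s(1)]) blast+
      have "(s, x) \<in> edges \<Longrightarrow> (s, y) \<in> edges" "(x, s) \<in> edges \<Longrightarrow> (y, s) \<in> edges"
        using hom fx fs by (auto simp: rel_hom_on_def)
      then show False
        using s True edges_P_Q[of s x] edges_P_Q[of s y] by auto
    qed
    moreover have "?X \<subseteq> carrier" "countable ?X"
      using x s by (auto simp: carrier_def)
    ultimately show ?thesis
      using countable_bound[of ?X] by (intro exI[of _ ?X] conjI) blast+
  qed
qed

end

section \<open>Naming the points of an infinite set\<close>

lemma inj_into_nat_set_set:
  assumes "|A| \<le>o ctwo ^c (ctwo ^c natLeq)"
  shows "\<exists>h :: 'a \<Rightarrow> nat set set. inj_on h (A :: 'a set)"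
proof -
  have Func_UNIV: "Func UNIV UNIV = (UNIV :: ('b \<Rightarrow> 'c) set)"
    by (auto simp: Func_def)
  have "ctwo ^c (ctwo ^c natLeq) = |UNIV :: ((nat \<Rightarrow> bool) \<Rightarrow> bool) set|"
    by (simp add: cexp_def ctwo_def Field_natLeq Field_card_of Func_UNIV)
  with assms obtain k :: "'a \<Rightarrow> (nat \<Rightarrow> bool) \<Rightarrow> bool" where k: "inj_on k A"
    using card_of_ordLeq[of A "UNIV :: ((nat \<Rightarrow> bool) \<Rightarrow> bool) set"] by auto
  have "inj (\<lambda>p :: (nat \<Rightarrow> bool) \<Rightarrow> bool. {N. p (\<lambda>n. n \<in> N)})"
  proof (rule injI)
    fix p q :: "(nat \<Rightarrow> bool) \<Rightarrow> bool"
    assume eq: "{N. p (\<lambda>n. n \<in> N)} = {N. q (\<lambda>n. n \<in> N)}"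
    show "p = q"
    proof
      fix r
      show "p r = q r"
        using eq[THEN eqset_imp_iff, of "Collect r"] by simp
    qed
  qed
  then have "inj_on ((\<lambda>p. {N. p (\<lambda>n. n \<in> N)}) \<circ> k) A"
    using k by (intro comp_inj_on) (auto intro: inj_on_subset)
  then show ?thesis by blast
qed

text \<open>
  Up to \<open>2 ^ \<omega>\<close> points, sets of natural numbers suffice as names and \<open>Q\<close> is empty. Beyond
  that, \<open>P\<close> gets the full size \<open>2 ^ \<omega>\<close>, so that its subsets provide enough names for \<open>Q\<close>.
\<close>
lemma ex_named_levels:
  fixes A :: "'a set" and h :: "'a \<Rightarrow> nat set set"
  assumes inf: "infinite A" and h: "inj_on h A"
  shows "\<exists>c P Q S F. named_levels c P Q S F \<and> range c \<union> P \<union> Q = A"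
proof (cases "|A| \<le>o |UNIV :: nat set set|")
  case True
  then obtain S :: "'a \<Rightarrow> nat set" where S: "inj_on S A"
    using card_of_ordLeq[of A "UNIV :: nat set set"] by auto
  obtain c :: "nat \<Rightarrow> 'a" where c: "inj c" "range c \<subseteq> A"
    using inf infinite_countable_subset by blast
  have "named_levels c (A - range c) {} S (\<lambda>_. {})"
    using c S by unfold_locales (auto intro: inj_on_subset)
  then show ?thesis
    using c(2) by (intro exI[of _ c] exI[of _ "A - range c"] exI[of _ "{}"]) auto
next
  case False
  then have "|UNIV :: nat set set| \<le>o |A|"
    using ordLeq_total[OF card_of_Well_order card_of_Well_order] by blast
  then obtain e :: "nat set \<Rightarrow> 'a" where e: "inj e" "range e \<subseteq> A"
    using card_of_ordLeq[of "UNIV :: nat set set" A] by auto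
  \<comment> \<open>Membership of 0 keeps the image of the core apart from that of the names.\<close>
  define c where "c n = e {Suc n}" for n
  define p where "p N = e (insert 0 (Suc ` N))" for N
  define Q where "Q = A - range c - range p"
  have inj_c: "inj c"
    by (rule injI) (auto simp: c_def dest: injD[OF e(1)])
  have inj_p: "inj p"
  proof (rule injI)
    fix M N assume "p M = p N"
    then have "insert 0 (Suc ` M) = insert 0 (Suc ` N)"
      using injD[OF e(1)] unfolding p_def by blast
    then show "M = N"
      by (rule insert_0_Suc_image_inj)
  qed
  have disj: "c n \<noteq> p N" for n N
  proof
    assume "c n = p N"
    then have "{Suc n} = insert 0 (Suc ` N)"
      using injD[OF e(1)] unfolding c_def p_def by blast
    then show False by blast
  qed
  have "named_levels c (range p) Q (inv p) (\<lambda>z. p ` h z)"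
  proof
    show "inj c" by (rule inj_c)
    show "range c \<inter> (range p \<union> Q) = {}"
      using disj by (auto simp: Q_def)
    show "range p \<inter> Q = {}" by (auto simp: Q_def)
    show "inj_on (inv p) (range p)" by (simp add: inj_on_inv_into)
    show "inj_on (\<lambda>z. p ` h z) Q"
      using h by (auto simp: Q_def inj_on_def inj_image_eq_iff[OF inj_p])
  qed auto
  moreover have "range c \<union> range p \<union> Q = A"
    using e(2) by (auto simp: Q_def c_def p_def)
  ultimately show ?thesis by blast
qed

section \<open>Finite sets\<close>

text \<open>
  Counting up from 0 gives \<open>k \<le> g k\<close>, and counting down from \<open>n - 1\<close> gives \<open>g k \<le> k\<close>.
\<close>
lemma strict_mono_on_lessThan_id:
  fixes g :: "nat \<Rightarrow> nat"
  assumes maps: "\<And>i. i < n \<Longrightarrow> g i < n"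
    and mono: "\<And>i j. i < j \<Longrightarrow> j < n \<Longrightarrow> g i < g j"
    and "k < n"
  shows "g k = k"
proof -
  have ge: "i < n \<Longrightarrow> i \<le> g i" for i
  proof (induction i)
    case (Suc i)
    then show ?case using mono[of i "Suc i"] by simp
  qed simp
  have le: "i < n \<Longrightarrow> g (n - Suc i) \<le> n - Suc i" for i
  proof (induction i)
    case 0
    then show ?case using maps[of "n - 1"] by simp
  next
    case (Suc i)
    then show ?case using mono[of "n - Suc (Suc i)" "n - Suc i"] by linarith
  qed
  show ?thesis
    using ge[of k] le[of "n - Suc k"] \<open>k < n\<close> by simp
qed

lemma finite_rigid:
  fixes A :: "'a set"
  assumes "finite A"
  shows "\<exists>R. R \<subseteq> A \<times> A \<and>
    (\<forall>f. rel_hom_on A R A f \<longrightarrow> (\<forall>x\<in>A. f x = x))"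
proof -
  obtain b where b: "bij_betw b {..<card A} A"
    using ex_bij_betw_nat_finite[OF assms] by (auto simp: atLeast0LessThan)
  let ?n = "card A"
  let ?R = "{(b i, b j) | i j. i < j \<and> j < ?n}"
  have b_in: "b i \<in> A" if "i < ?n" for i
    using bij_betwE[OF b] that by simp
  have b_eq: "i = j" if "b i = b j" "i < ?n" "j < ?n" for i j
    using b that by (auto simp: bij_betw_def dest: inj_onD)
  have "f x = x" if hom: "rel_hom_on A ?R A f" and x: "x \<in> A" for f x
  proof -
    have "\<forall>i. \<exists>j. i < ?n \<longrightarrow> j < ?n \<and> f (b i) = b j"
    proof (intro allI)
      fix i
      show "\<exists>j. i < ?n \<longrightarrow> j < ?n \<and> f (b i) = b j"
      proof (cases "i < ?n")
        case True
        then have "f (b i) \<in> b ` {..<?n}"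
          using hom b_in bij_betw_imp_surj_on[OF b] by (auto simp: rel_hom_on_def)
        then show ?thesis by auto
      qed simp
    qed
    then obtain g where g: "\<And>i. i < ?n \<Longrightarrow> g i < ?n \<and> f (b i) = b (g i)" by metis
    have mono: "g i < g j" if "i < j" "j < ?n" for i j
    proof -
      have gij: "g i < ?n" "f (b i) = b (g i)" "g j < ?n" "f (b j) = b (g j)"
        using g[of i] g[of j] that by simp_all
      have "(b i, b j) \<in> ?R" using that by blast
      then have "(f (b i), f (b j)) \<in> ?R"
        using hom b_in that by (auto simp: rel_hom_on_def)
      then obtain i' j' where "b (g i) = b i'" "b (g j) = b j'" "i' < j'" "j' < ?n"
        using gij by auto
      then show ?thesis
        using b_eq[of "g i" i'] b_eq[of "g j" j'] gij by auto
    qed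
    obtain k where k: "k < ?n" "x = b k"
      using x bij_betw_imp_surj_on[OF b] by auto
    have "g k = k"
      by (rule strict_mono_on_lessThan_id[of ?n]) (use g mono k in auto)
    then show ?thesis using g[of k] k by simp
  qed
  moreover have "?R \<subseteq> A \<times> A" using b_in by auto
  ultimately show ?thesis by blast
qed

section \<open>Countably rigid relations\<close>

theorem mainTheorem2:
  fixes A :: "'a set"
  assumes "|A| \<le>o ctwo ^c (ctwo ^c natLeq)"
  shows "\<exists>R. R \<subseteq> A \<times> A \<and>
    (\<forall>x\<in>A. \<forall>y\<in>A. x \<noteq> y \<longrightarrow>
      (\<exists>X. {x} \<subseteq> X \<and> X \<subseteq> A \<and> |X| \<le>o natLeq \<and>
        \<not> (\<exists>f. f x = y \<and> rel_hom_on A R X f)))"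
proof (cases "finite A")
  case True
  then have small: "|A| \<le>o natLeq"
    by (simp add: finite_iff_ordLess_natLeq ordLess_imp_ordLeq)
  obtain R where "R \<subseteq> A \<times> A" and fix_all: "\<forall>f. rel_hom_on A R A f \<longrightarrow> (\<forall>x\<in>A. f x = x)"
    using finite_rigid[OF True] by blast
  moreover have "\<not> (\<exists>f. f x = y \<and> rel_hom_on A R A f)" if "x \<in> A" "x \<noteq> y" for x y
    using fix_all that by metis
  ultimately show ?thesis
    using small by (intro exI[of _ R] conjI ballI impI exI[of _ A]) simp_all
next
  case False
  obtain h :: "'a \<Rightarrow> nat set set" where "inj_on h A"
    using inj_into_nat_set_set[OF assms] by blast
  then obtain c P Q S F where "named_levels c P Q S F" and A: "range c \<union> P \<union> Q = A"
    using ex_named_levels[OF False] by blast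
  then interpret named_levels c P Q S F by simp
  have "carrier = A" using A by (simp add: carrier_def)
  then show ?thesis
    using edges_sub countably_rigid by (intro exI[of _ edges]) auto
qed

end
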